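(* Let $\mathfrak a\subseteq A$ be an ideal and $t\ge0$ a real number. For all positive integers $n$, $$\tau((\mathfrak a^n)^t)=\tau(\mathfrak a^{nt}).$$
   Context: Fix a prime $p$. $K^\circ$ denotes the $p$-adic completion of $\mathbb Z_p[p^{1/p^\infty}]$. A $K^\circ$-algebra $S$ is integral perfectoid if it is $p$-adically complete, $p$-torsion free, and Frobenius induces an isomorphism $S/p^{1/p}\to S/p$; by convention every integral perfectoid $S$ is also assumed integrally closed in $S[1/p]$. An element $z$ of a $K^\circ$-module (or a module) is almost zero if it is annihilated by $p^{1/p^k}$ for all $k>0$; "$p^{1/p^\infty}z=0$" means $z$ is almost zero. A compatible system of $p$-power roots of $g$ in $S$ is a sequence $\{g^{1/p^e}\}_{e\ge 0}$ with $g^{1/p^0}=g$ and $(g^{1/p^{e+1}})^p=g^{1/p^e}$. A ring map $A\to S$ with $S$ a $K^\circ$-algebra is almost flat if $\operatorname{Tor}_i^A(M,S)$ is almost zero for all $A$-modules $M$ and $i>0$. $(A,\mathfrak m)$ is a complete regular local ring of mixed characteristic $(0,p)$ and dimension $d$. $A\to A_\infty$ is a fixed map to an integral perfectoid $K^\circ$-algebra such that: (a) every element of $A$ has a compatible system of $p$-power roots in $A_\infty$; (b) $A\to A_\infty$ is almost flat (so it is injective, and nonzero elements of $A$ are nonzerodivisors on $A_\infty$); (c) if $M$ is an $A$-module with $M\otimes_AA_\infty$ almost zero, then $M=0$. For an ideal $\mathfrak a\subseteq A$ and real $t\ge0$, let $0^{\diamondsuit\mathfrak a^t}_{H^d_{\mathfrak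 m}(A)}$ be the set of $\eta\in H^d_{\mathfrak m}(A)$ such that for all $e>0$, all $f\in\mathfrak a^{\lceil tp^e\rceil}$ and all $p^e$-th roots $f^{1/p^e}\in A_\infty$ of $f$ that are part of some compatible system of $p$-power roots of $f$, one has $p^{1/p^\infty}f^{1/p^e}\eta=0$ in $H^d_{\mathfrak m}(A_\infty)$. Put $\tau^\sharp(\mathfrak a^t)=\operatorname{Ann}_A\big(0^{\diamondsuit\mathfrak a^t}_{H^d_{\mathfrak m}(A)}\big)$ and $\tau(\mathfrak a^t)=\sum_{t'>t}\tau^\sharp(\mathfrak a^{t'})$, which equals $\tau^\sharp(\mathfrak a^{t+\epsilon})$ for all $0<\epsilon\ll1$. The exponent $t$ is formal: $\tau((\mathfrak a^n)^t)$ is this definition applied to the ideal $\mathfrak a^n$ with exponent $t$, and $\tau(\mathfrak a^{nt})$ is the definition applied to $\mathfrak a$ with exponent $nt$. *)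

theory Defs
  imports Complex_Main "HOL-Library.Extended_Nat"
    "HOL-Algebra.Module" "HOL-Algebra.Ideal_Product" "HOL-Algebra.IntRing"
    "HOL-Algebra.Ring_Divisibility"
begin

section \<open>Modules\<close>

(* Module records extend ring records; the fields mult and one carry no information for a plain
   module and are left undefined below. *)

definition linear_maps ::
  "('a, 'm) ring_scheme \<Rightarrow> ('a, 'b, 'n) module_scheme \<Rightarrow> ('a, 'c, 'o) module_scheme \<Rightarrow> ('b \<Rightarrow> 'c) set"
  where "linear_maps R M N =
    {f. f \<in> carrier M \<rightarrow> carrier N \<and>
        (\<forall>x\<in>carrier M. \<forall>y\<in>carrier M. f (x \<oplus>\<^bsub>M\<^esub> y) = f x \<oplus>\<^bsub>N\<^esub> f y) \<and>
        (\<forall>a\<in>carrier R. \<forall>x\<in>carrier M. f (a \<odot>\<^bsub>M\<^esub> x) = a \<odot>\<^bsub>N\<^esub> f x)}"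

definition submodule_span ::
  "('a, 'm) ring_scheme \<Rightarrow> ('a, 'b, 'n) module_scheme \<Rightarrow> 'b set \<Rightarrow> 'b set"
  where "submodule_span R M X = \<Inter>{N. submodule N R M \<and> X \<subseteq> N}"

(* Functions on a quotient are written as unions over all representatives: all members of the
   union are the same coset. *)
definition quot_module :: "('a, 'b, 'n) module_scheme \<Rightarrow> 'b set \<Rightarrow> ('a, 'b set) module"
  where "quot_module M N =
    \<lparr>carrier = a_rcosets\<^bsub>M\<^esub> N, monoid.mult = undefined, one = undefined,
     zero = N, add = set_add M,
     smult = (\<lambda>a X. \<Union>x\<in>X. N +>\<^bsub>M\<^esub> (a \<odot>\<^bsub>M\<^esub> x))\<rparr>"

definition algebra_module :: "('a \<Rightarrow> 'b) \<Rightarrow> ('b, 'n) ring_scheme \<Rightarrow> ('a, 'b) module"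
  where "algebra_module \<phi> S =
    \<lparr>carrier = carrier S, monoid.mult = monoid.mult S, one = one S, zero = zero S, add = add S,
     smult = (\<lambda>a s. \<phi> a \<otimes>\<^bsub>S\<^esub> s)\<rparr>"

definition single :: "('a, 'm) ring_scheme \<Rightarrow> 'x \<Rightarrow> 'a \<Rightarrow> 'x \<Rightarrow> 'a"
  where "single R x a = (\<lambda>y. if y = x then a else \<zero>\<^bsub>R\<^esub>)"

definition free_module :: "('a, 'm) ring_scheme \<Rightarrow> 'x set \<Rightarrow> ('a, 'x \<Rightarrow> 'a) module"
  where "free_module R X =
    \<lparr>carrier = {u. (\<forall>x\<in>X. u x \<in> carrier R) \<and> (\<forall>x. x \<notin> X \<longrightarrow> u x = \<zero>\<^bsub>R\<^esub>) \<and>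
                   finite {x. u x \<noteq> \<zero>\<^bsub>R\<^esub>}},
     monoid.mult = undefined, one = undefined,
     zero = (\<lambda>_. \<zero>\<^bsub>R\<^esub>), add = (\<lambda>u v x. u x \<oplus>\<^bsub>R\<^esub> v x),
     smult = (\<lambda>a u x. a \<otimes>\<^bsub>R\<^esub> u x)\<rparr>"

(* The linear map of free modules sending the basis vector of x to that of h x. *)
definition push_forward :: "('a, 'm) ring_scheme \<Rightarrow> ('x \<Rightarrow> 'y) \<Rightarrow> ('x \<Rightarrow> 'a) \<Rightarrow> 'y \<Rightarrow> 'a"
  where "push_forward R h u = (\<lambda>y. \<Oplus>\<^bsub>R\<^esub>x\<in>{x. u x \<noteq> \<zero>\<^bsub>R\<^esub> \<and> h x = y}. u x)"


section \<open>Tensor products\<close>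

abbreviation tensor_free ::
  "('a, 'm) ring_scheme \<Rightarrow> ('a, 'b, 'n) module_scheme \<Rightarrow> ('a, 'c, 'o) module_scheme
    \<Rightarrow> ('a, 'b \<times> 'c \<Rightarrow> 'a) module"
  where "tensor_free R M N \<equiv> free_module R (carrier M \<times> carrier N)"

definition tensor_relations ::
  "('a, 'm) ring_scheme \<Rightarrow> ('a, 'b, 'n) module_scheme \<Rightarrow> ('a, 'c, 'o) module_scheme
    \<Rightarrow> ('b \<times> 'c \<Rightarrow> 'a) set"
  where "tensor_relations R M N = (let F = tensor_free R M N; e = (\<lambda>m n. single R (m, n) \<one>\<^bsub>R\<^esub>) in
     submodule_span R F
      ({e (m \<oplus>\<^bsub>M\<^esub> m') n \<ominus>\<^bsub>F\<^esub> (e m n \<oplus>\<^bsub>F\<^esub> e m' n) | m m' n.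
          m \<in> carrier M \<and> m' \<in> carrier M \<and> n \<in> carrier N} \<union>
       {e m (n \<oplus>\<^bsub>N\<^esub> n') \<ominus>\<^bsub>F\<^esub> (e m n \<oplus>\<^bsub>F\<^esub> e m n') | m n n'.
          m \<in> carrier M \<and> n \<in> carrier N \<and> n' \<in> carrier N} \<union>
       {e (a \<odot>\<^bsub>M\<^esub> m) n \<ominus>\<^bsub>F\<^esub> a \<odot>\<^bsub>F\<^esub> e m n | a m n.
          a \<in> carrier R \<and> m \<in> carrier M \<and> n \<in> carrier N} \<union>
       {e m (a \<odot>\<^bsub>N\<^esub> n) \<ominus>\<^bsub>F\<^esub> a \<odot>\<^bsub>F\<^esub> e m n | a m n.
          a \<in> carrier R \<and> m \<in> carrier M \<and> n \<in> carrier N}))"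

definition tensor_product ::
  "('a, 'm) ring_scheme \<Rightarrow> ('a, 'b, 'n) module_scheme \<Rightarrow> ('a, 'c, 'o) module_scheme
    \<Rightarrow> ('a, ('b \<times> 'c \<Rightarrow> 'a) set) module"
  where "tensor_product R M N = quot_module (tensor_free R M N) (tensor_relations R M N)"

(* The linear map f \<otimes> g into the tensor product of M' and N'. *)
definition tensor_map ::
  "('a, 'm) ring_scheme \<Rightarrow> ('a, 'b, 'n) module_scheme \<Rightarrow> ('a, 'c, 'o) module_scheme
    \<Rightarrow> ('d \<Rightarrow> 'b) \<Rightarrow> ('e \<Rightarrow> 'c) \<Rightarrow> ('d \<times> 'e \<Rightarrow> 'a) set \<Rightarrow> ('b \<times> 'c \<Rightarrow> 'a) set"
  where "tensor_map R M' N' f g X =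
    (\<Union>u\<in>X. tensor_relations R M' N' +>\<^bsub>tensor_free R M' N'\<^esub> push_forward R (map_prod f g) u)"

(* M \<otimes> S over A, as an S-module, for the A-algebra S with structure map \<phi>. *)
definition base_change ::
  "('a, 'm) ring_scheme \<Rightarrow> ('a \<Rightarrow> 's) \<Rightarrow> ('s, 'n) ring_scheme \<Rightarrow> ('a, 'b, 'o) module_scheme
    \<Rightarrow> ('s, ('b \<times> 's \<Rightarrow> 'a) set) module"
  where "base_change A \<phi> S M = (let N = algebra_module \<phi> S; T = tensor_product A M N in
    \<lparr>carrier = carrier T, monoid.mult = undefined, one = undefined, zero = zero T, add = add T,
     smult = (\<lambda>s. tensor_map A M N (\<lambda>m. m) (\<lambda>x. s \<otimes>\<^bsub>S\<^esub> x))\<rparr>)"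


section \<open>Tor\<close>

(* A free resolution of M: the i-th term is free on X i, D i maps term i+1 to term i, and
   \<epsilon> is the augmentation. *)
definition free_resolution ::
  "('a, 'm) ring_scheme \<Rightarrow> ('a, 'b, 'n) module_scheme \<Rightarrow> (nat \<Rightarrow> 'x set)
    \<Rightarrow> (nat \<Rightarrow> ('x \<Rightarrow> 'a) \<Rightarrow> ('x \<Rightarrow> 'a)) \<Rightarrow> (('x \<Rightarrow> 'a) \<Rightarrow> 'b) \<Rightarrow> bool"
  where "free_resolution R M X D \<epsilon> \<longleftrightarrow> (let F = (\<lambda>i. free_module R (X i)) in
    \<epsilon> \<in> linear_maps R (F 0) M \<and>
    (\<forall>i. D i \<in> linear_maps R (F (Suc i)) (F i)) \<and>
    \<epsilon> ` carrier (F 0) = carrier M \<and>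
    D 0 ` carrier (F 1) = {u \<in> carrier (F 0). \<epsilon> u = \<zero>\<^bsub>M\<^esub>} \<and>
    (\<forall>i. D (Suc i) ` carrier (F (Suc (Suc i))) =
         {u \<in> carrier (F (Suc i)). D i u = \<zero>\<^bsub>F i\<^esub>}))"

(* The i-th Tor module of M and S, computed from a free resolution (X, D) of M. *)
definition Tor_module ::
  "('a, 'm) ring_scheme \<Rightarrow> ('a \<Rightarrow> 's) \<Rightarrow> ('s, 'n) ring_scheme \<Rightarrow> (nat \<Rightarrow> 'x set)
    \<Rightarrow> (nat \<Rightarrow> ('x \<Rightarrow> 'a) \<Rightarrow> ('x \<Rightarrow> 'a)) \<Rightarrow> nat \<Rightarrow> ('s, (('x \<Rightarrow> 'a) \<times> 's \<Rightarrow> 'a) set set) module"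
  where "Tor_module A \<phi> S X D i =
   (let F = (\<lambda>j. free_module A (X j));
        C = (\<lambda>j. base_change A \<phi> S (F j));
        d = (\<lambda>j. tensor_map A (F j) (algebra_module \<phi> S) (D j) (\<lambda>x. x));
        Z = (case i of 0 \<Rightarrow> carrier (C 0)
             | Suc j \<Rightarrow> {z \<in> carrier (C (Suc j)). d j z = \<zero>\<^bsub>C j\<^esub>})
    in quot_module ((C i)\<lparr>carrier := Z\<rparr>) (d i ` carrier (C (Suc i))))"


section \<open>Localization and local cohomology\<close>

inductive_set mult_closure :: "('a, 'm) ring_scheme \<Rightarrow> 'a set \<Rightarrow> 'a set"
  for R and X where
    one: "\<one>\<^bsub>R\<^esub> \<in> mult_closure R X"
  | mult: "\<lbrakk>x \<in> X; s \<in> mult_closure R X\<rbrakk> \<Longrightarrow> x \<otimes>\<^bsub>R\<^esub> s \<in> mult_closure R X"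

(* The class of the fraction m/s in the localization of M at the multiplicative set T. *)
definition frac :: "('a, 'm) ring_scheme \<Rightarrow> 'a set \<Rightarrow> ('a, 'b, 'n) module_scheme
    \<Rightarrow> 'b \<Rightarrow> 'a \<Rightarrow> ('b \<times> 'a) set"
  where "frac R T M m s =
    {(n, t). n \<in> carrier M \<and> t \<in> T \<and> (\<exists>u\<in>T. u \<odot>\<^bsub>M\<^esub> (t \<odot>\<^bsub>M\<^esub> m) = u \<odot>\<^bsub>M\<^esub> (s \<odot>\<^bsub>M\<^esub> n))}"

(* The fields mult and one are meaningful if M is an R-algebra. *)
definition localization :: "('a, 'm) ring_scheme \<Rightarrow> 'a set \<Rightarrow> ('a, 'b, 'n) module_scheme
    \<Rightarrow> ('a, ('b \<times> 'a) set) module"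
  where "localization R T M =
    \<lparr>carrier = {frac R T M m s | m s. m \<in> carrier M \<and> s \<in> T},
     monoid.mult = (\<lambda>X Y. \<Union>(m, s)\<in>X. \<Union>(n, t)\<in>Y. frac R T M (m \<otimes>\<^bsub>M\<^esub> n) (s \<otimes>\<^bsub>R\<^esub> t)),
     one = frac R T M \<one>\<^bsub>M\<^esub> \<one>\<^bsub>R\<^esub>,
     zero = frac R T M \<zero>\<^bsub>M\<^esub> \<one>\<^bsub>R\<^esub>,
     add = (\<lambda>X Y. \<Union>(m, s)\<in>X. \<Union>(n, t)\<in>Y.
              frac R T M (t \<odot>\<^bsub>M\<^esub> m \<oplus>\<^bsub>M\<^esub> s \<odot>\<^bsub>M\<^esub> n) (s \<otimes>\<^bsub>R\<^esub> t)),
     smult = (\<lambda>a X. \<Union>(m, s)\<in>X. frac R T M (a \<odot>\<^bsub>M\<^esub> m) s)\<rparr>"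

(* For f from M to N and a multiplicative set T containing the denominators of X, the image of X
   in the localization of N at T. With f the identity this is the canonical map between
   localizations of M; with T unchanged it is the localization of f. *)
definition frac_map :: "('a, 'm) ring_scheme \<Rightarrow> 'a set \<Rightarrow> ('a, 'c, 'n) module_scheme
    \<Rightarrow> ('b \<Rightarrow> 'c) \<Rightarrow> ('b \<times> 'a) set \<Rightarrow> ('c \<times> 'a) set"
  where "frac_map R T N f X = (\<Union>(m, s)\<in>X. frac R T N (f m) s)"

definition cech_index :: "'a list \<Rightarrow> nat \<Rightarrow> nat set set"
  where "cech_index xs i = {I. I \<subseteq> {..<length xs} \<and> card I = i}"

(* The localization of M inverting the members of xs with index in I. *)
abbreviation cech_loc :: "('a, 'm) ring_scheme \<Rightarrow> 'a list \<Rightarrow> nat set \<Rightarrow> ('a, 'b, 'n) module_scheme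
    \<Rightarrow> ('a, ('b \<times> 'a) set) module"
  where "cech_loc R xs I M \<equiv> localization R (mult_closure R ((!) xs ` I)) M"

definition cech_cochains :: "('a, 'm) ring_scheme \<Rightarrow> 'a list \<Rightarrow> nat \<Rightarrow> ('a, 'b, 'n) module_scheme
    \<Rightarrow> ('a, nat set \<Rightarrow> ('b \<times> 'a) set) module"
  where "cech_cochains R xs i M =
    \<lparr>carrier = (\<Pi>\<^sub>E I\<in>cech_index xs i. carrier (cech_loc R xs I M)),
     monoid.mult = undefined, one = undefined,
     zero = (\<lambda>I\<in>cech_index xs i. \<zero>\<^bsub>cech_loc R xs I M\<^esub>),
     add = (\<lambda>c c'. \<lambda>I\<in>cech_index xs i. c I \<oplus>\<^bsub>cech_loc R xs I M\<^esub> c' I),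
     smult = (\<lambda>a c. \<lambda>I\<in>cech_index xs i. a \<odot>\<^bsub>cech_loc R xs I M\<^esub> c I)\<rparr>"

definition cech_differential :: "('a, 'm) ring_scheme \<Rightarrow> 'a list \<Rightarrow> nat
    \<Rightarrow> ('a, 'b, 'n) module_scheme \<Rightarrow> (nat set \<Rightarrow> ('b \<times> 'a) set) \<Rightarrow> (nat set \<Rightarrow> ('b \<times> 'a) set)"
  where "cech_differential R xs i M c =
    (\<lambda>J\<in>cech_index xs (Suc i). \<Oplus>\<^bsub>cech_loc R xs J M\<^esub>j\<in>J.
       (let y = frac_map R (mult_closure R ((!) xs ` J)) M (\<lambda>m. m) (c (J - {j}))
        in if even (card {l\<in>J. l < j}) then y else \<ominus>\<^bsub>cech_loc R xs J M\<^esub> y))"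

definition cech_cocycles :: "('a, 'm) ring_scheme \<Rightarrow> 'a list \<Rightarrow> nat \<Rightarrow> ('a, 'b, 'n) module_scheme
    \<Rightarrow> (nat set \<Rightarrow> ('b \<times> 'a) set) set"
  where "cech_cocycles R xs i M =
    {c \<in> carrier (cech_cochains R xs i M).
       cech_differential R xs i M c = \<zero>\<^bsub>cech_cochains R xs (Suc i) M\<^esub>}"

definition cech_coboundaries :: "('a, 'm) ring_scheme \<Rightarrow> 'a list \<Rightarrow> nat
    \<Rightarrow> ('a, 'b, 'n) module_scheme \<Rightarrow> (nat set \<Rightarrow> ('b \<times> 'a) set) set"
  where "cech_coboundaries R xs i M =
    (case i of 0 \<Rightarrow> {\<zero>\<^bsub>cech_cochains R xs 0 M\<^esub>}
     | Suc j \<Rightarrow> cech_differential R xs j M ` carrier (cech_cochains R xs j M))"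

(* Local cohomology of M, in degree i, with support in the ideal generated by xs, as the cohomology
   of the Cech complex of xs. Over a Noetherian ring R this depends only on that ideal (up to
   canonical isomorphism) and is the i-th derived functor of sections with support, for every
   R-module M. *)
definition local_cohomology :: "('a, 'm) ring_scheme \<Rightarrow> 'a list \<Rightarrow> nat
    \<Rightarrow> ('a, 'b, 'n) module_scheme \<Rightarrow> ('a, (nat set \<Rightarrow> ('b \<times> 'a) set) set) module"
  where "local_cohomology R xs i M =
    quot_module ((cech_cochains R xs i M)\<lparr>carrier := cech_cocycles R xs i M\<rparr>)
      (cech_coboundaries R xs i M)"

(* The map into the local cohomology of N induced by an R-linear map f from M to N. *)
definition local_cohomology_map :: "('a, 'm) ring_scheme \<Rightarrow> 'a list \<Rightarrow> nat
    \<Rightarrow> ('a, 'c, 'n) module_scheme \<Rightarrow> ('b \<Rightarrow> 'c)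
    \<Rightarrow> (nat set \<Rightarrow> ('b \<times> 'a) set) set \<Rightarrow> (nat set \<Rightarrow> ('c \<times> 'a) set) set"
  where "local_cohomology_map R xs i N f X =
    (\<Union>c\<in>X. cech_coboundaries R xs i N +>\<^bsub>cech_cochains R xs i N\<^esub>
       (\<lambda>I\<in>cech_index xs i. frac_map R (mult_closure R ((!) xs ` I)) N f (c I)))"


section \<open>Completions and regular local rings\<close>

abbreviation ideal_power :: "('a, 'm) ring_scheme \<Rightarrow> 'a set \<Rightarrow> nat \<Rightarrow> 'a set"
  where "ideal_power R I n \<equiv> I [^]\<^bsub>ideals_set R\<^esub> n"

(* The inverse limit of the quotients by the powers of I. Elements of the quotients are cosets, so
   compatibility of a sequence means that it is decreasing for inclusion. *)
definition adic_completion :: "('a, 'm) ring_scheme \<Rightarrow> 'a set \<Rightarrow> (nat \<Rightarrow> 'a set) ring"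
  where "adic_completion R I = (let Q = (\<lambda>n. R Quot (ideal_power R I n)) in
    \<lparr>carrier = {c. \<forall>n. c n \<in> carrier (Q n) \<and> c (Suc n) \<subseteq> c n},
     monoid.mult = (\<lambda>c c' n. c n \<otimes>\<^bsub>Q n\<^esub> c' n),
     one = (\<lambda>n. \<one>\<^bsub>Q n\<^esub>),
     zero = (\<lambda>n. \<zero>\<^bsub>Q n\<^esub>),
     add = (\<lambda>c c' n. c n \<oplus>\<^bsub>Q n\<^esub> c' n)\<rparr>)"

definition completion_map :: "('a, 'm) ring_scheme \<Rightarrow> 'a set \<Rightarrow> 'a \<Rightarrow> nat \<Rightarrow> 'a set"
  where "completion_map R I x = (\<lambda>n. ideal_power R I n +>\<^bsub>R\<^esub> x)"

(* Complete includes separated. *)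
definition adically_complete :: "('a, 'm) ring_scheme \<Rightarrow> 'a set \<Rightarrow> bool"
  where "adically_complete R I \<longleftrightarrow>
    bij_betw (completion_map R I) (carrier R) (carrier (adic_completion R I))"

definition krull_dim :: "('a, 'm) ring_scheme \<Rightarrow> enat"
  where "krull_dim R = Sup {enat n | n.
    \<exists>P. (\<forall>i\<le>n. primeideal (P i) R) \<and> (\<forall>i<n. P i \<subset> P (Suc i))}"

definition noetherian_local_ring :: "('a, 'm) ring_scheme \<Rightarrow> 'a set \<Rightarrow> bool"
  where "noetherian_local_ring A \<mm> \<longleftrightarrow>
    cring A \<and> noetherian_ring A \<and> maximalideal \<mm> A \<and> (\<forall>I. maximalideal I A \<longrightarrow> I = \<mm>)"

definition regular_local_ring :: "('a, 'm) ring_scheme \<Rightarrow> 'a set \<Rightarrow> nat \<Rightarrow> bool"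
  where "regular_local_ring A \<mm> d \<longleftrightarrow>
    noetherian_local_ring A \<mm> \<and> krull_dim A = enat d \<and>
    (\<exists>xs. set xs \<subseteq> carrier A \<and> length xs = d \<and> \<mm> = Idl\<^bsub>A\<^esub> (set xs))"

(* A has characteristic 0 and, p being prime, A/\<mm> has characteristic p. *)
definition mixed_characteristic :: "('a, 'm) ring_scheme \<Rightarrow> 'a set \<Rightarrow> nat \<Rightarrow> bool"
  where "mixed_characteristic A \<mm> p \<longleftrightarrow>
    (\<forall>n::nat. n > 0 \<longrightarrow> [n] \<cdot>\<^bsub>A\<^esub> \<one>\<^bsub>A\<^esub> \<noteq> \<zero>\<^bsub>A\<^esub>) \<and> [p] \<cdot>\<^bsub>A\<^esub> \<one>\<^bsub>A\<^esub> \<in> \<mm>"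


section \<open>The base ring and integral perfectoid algebras\<close>

definition padic_integers :: "nat \<Rightarrow> (nat \<Rightarrow> int set) ring"
  where "padic_integers p = adic_completion \<Z> (PIdl\<^bsub>\<Z>\<^esub> (int p))"

definition monoid_algebra :: "('a, 'm) ring_scheme \<Rightarrow> 'e::comm_monoid_add set \<Rightarrow> ('e \<Rightarrow> 'a) ring"
  where "monoid_algebra R E =
    \<lparr>carrier = carrier (free_module R E),
     monoid.mult = (\<lambda>u v e. \<Oplus>\<^bsub>R\<^esub>x\<in>{(a, b). u a \<noteq> \<zero>\<^bsub>R\<^esub> \<and> v b \<noteq> \<zero>\<^bsub>R\<^esub> \<and> a + b = e}.
               u (fst x) \<otimes>\<^bsub>R\<^esub> v (snd x)),
     one = single R 0 \<one>\<^bsub>R\<^esub>,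
     zero = zero (free_module R E),
     add = add (free_module R E)\<rparr>"

definition p_power_exponents :: "nat \<Rightarrow> rat set"
  where "p_power_exponents p = {q. q \<ge> 0 \<and> (\<exists>k::nat. q * of_nat p ^ k \<in> \<int>)}"

(* The p-adic integers with all roots T^(1/p^e) of a variable T adjoined. *)
abbreviation padic_root_polys :: "nat \<Rightarrow> (rat \<Rightarrow> nat \<Rightarrow> int set) ring"
  where "padic_root_polys p \<equiv> monoid_algebra (padic_integers p) (p_power_exponents p)"

(* The monomial with exponent 1/p^k. *)
abbreviation root_monomial :: "nat \<Rightarrow> nat \<Rightarrow> rat \<Rightarrow> nat \<Rightarrow> int set"
  where "root_monomial p k \<equiv> single (padic_integers p) (1 / of_nat p ^ k) \<one>\<^bsub>padic_integers p\<^esub>"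

(* The principal ideal generated by T - p. *)
abbreviation root_ideal :: "nat \<Rightarrow> (rat \<Rightarrow> nat \<Rightarrow> int set) set"
  where "root_ideal p \<equiv> PIdl\<^bsub>padic_root_polys p\<^esub>
    (root_monomial p 0 \<ominus>\<^bsub>padic_root_polys p\<^esub> [p] \<cdot>\<^bsub>padic_root_polys p\<^esub> \<one>\<^bsub>padic_root_polys p\<^esub>)"

(* The p-adic integers with all the roots p^(1/p^e) of p adjoined, presented by T = p. *)
definition padic_with_roots :: "nat \<Rightarrow> (rat \<Rightarrow> nat \<Rightarrow> int set) set ring"
  where "padic_with_roots p = padic_root_polys p Quot root_ideal p"

abbreviation padic_with_roots_p_ideal :: "nat \<Rightarrow> (rat \<Rightarrow> nat \<Rightarrow> int set) set set"
  where "padic_with_roots_p_ideal p \<equiv>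
    PIdl\<^bsub>padic_with_roots p\<^esub> ([p] \<cdot>\<^bsub>padic_with_roots p\<^esub> \<one>\<^bsub>padic_with_roots p\<^esub>)"

type_synonym K_elem = "nat \<Rightarrow> (rat \<Rightarrow> nat \<Rightarrow> int set) set set"

definition K_int :: "nat \<Rightarrow> K_elem ring"
  where "K_int p = adic_completion (padic_with_roots p) (padic_with_roots_p_ideal p)"

(* The element p^(1/p^k). *)
definition K_root :: "nat \<Rightarrow> nat \<Rightarrow> K_elem"
  where "K_root p k = completion_map (padic_with_roots p) (padic_with_roots_p_ideal p)
    (root_ideal p +>\<^bsub>padic_root_polys p\<^esub> root_monomial p k)"

(* S is a K_int p-algebra via \<kappa>, and M is an S-module. *)
definition almost_zero :: "nat \<Rightarrow> (K_elem \<Rightarrow> 's) \<Rightarrow> ('s, 'b, 'n) module_scheme \<Rightarrow> bool"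
  where "almost_zero p \<kappa> M \<longleftrightarrow>
    (\<forall>x\<in>carrier M. \<forall>k>0. \<kappa> (K_root p k) \<odot>\<^bsub>M\<^esub> x = \<zero>\<^bsub>M\<^esub>)"

definition integrally_closed_in_localization :: "('s, 'm) ring_scheme \<Rightarrow> 's \<Rightarrow> bool"
  where "integrally_closed_in_localization S g \<longleftrightarrow>
   (let T = mult_closure S {g}; M = algebra_module (\<lambda>x. x) S; L = localization S T M in
    \<forall>z\<in>carrier L. \<forall>n>0. \<forall>a \<in> {..<n::nat} \<rightarrow> carrier S.
      z [^]\<^bsub>L\<^esub> n \<oplus>\<^bsub>L\<^esub> (\<Oplus>\<^bsub>L\<^esub>i\<in>{..<n}. a i \<odot>\<^bsub>L\<^esub> z [^]\<^bsub>L\<^esub> i) = \<zero>\<^bsub>L\<^esub> \<longrightarrow>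
      (\<exists>s\<in>carrier S. z = frac S T M s \<one>\<^bsub>S\<^esub>))"

definition integral_perfectoid :: "nat \<Rightarrow> (K_elem \<Rightarrow> 's) \<Rightarrow> ('s, 'm) ring_scheme \<Rightarrow> bool"
  where "integral_perfectoid p \<kappa> S \<longleftrightarrow>
    cring S \<and> \<kappa> \<in> ring_hom (K_int p) S \<and>
    (let p' = [p] \<cdot>\<^bsub>S\<^esub> \<one>\<^bsub>S\<^esub>; J = PIdl\<^bsub>S\<^esub> p'; J' = PIdl\<^bsub>S\<^esub> (\<kappa> (K_root p 1)) in
      adically_complete S J \<and>
      (\<forall>x\<in>carrier S. p' \<otimes>\<^bsub>S\<^esub> x = \<zero>\<^bsub>S\<^esub> \<longrightarrow> x = \<zero>\<^bsub>S\<^esub>) \<and>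
      (\<exists>F\<in>ring_iso (S Quot J') (S Quot J).
         \<forall>x\<in>carrier S. F (J' +>\<^bsub>S\<^esub> x) = J +>\<^bsub>S\<^esub> (x [^]\<^bsub>S\<^esub> p)) \<and>
      integrally_closed_in_localization S p')"

definition compatible_roots :: "nat \<Rightarrow> ('s, 'm) ring_scheme \<Rightarrow> 's \<Rightarrow> (nat \<Rightarrow> 's) \<Rightarrow> bool"
  where "compatible_roots p S x g \<longleftrightarrow>
    (\<forall>e. g e \<in> carrier S) \<and> g 0 = x \<and> (\<forall>e. g (Suc e) [^]\<^bsub>S\<^esub> p = g e)"

(* HOL cannot quantify over modules of all types. The type (nat \<Rightarrow> 'a) set contains the quotients
   of submodules of A^N, hence a copy of every finitely generated A-module; and a module on an
   infinite type at least as large as A has a free resolution with bases in that type. Tor commutes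
   with filtered colimits, so this is almost flatness with respect to all modules. *)
definition almost_flat ::
  "nat \<Rightarrow> (K_elem \<Rightarrow> 's) \<Rightarrow> ('a, 'm) ring_scheme \<Rightarrow> ('a \<Rightarrow> 's) \<Rightarrow> ('s, 'n) ring_scheme \<Rightarrow> bool"
  where "almost_flat p \<kappa> A \<phi> S \<longleftrightarrow>
    (\<forall>(M :: ('a, (nat \<Rightarrow> 'a) set) module) (X :: nat \<Rightarrow> (nat \<Rightarrow> 'a) set set) D \<epsilon>.
       Module.module A M \<and> free_resolution A M X D \<epsilon> \<longrightarrow>
       (\<forall>i>0. almost_zero p \<kappa> (Tor_module A \<phi> S X D i)))"

(* In the presence of almost flatness it suffices to consider cyclic modules A/I, so the
   restriction to modules on (nat \<Rightarrow> 'a) set loses nothing here either. *)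
definition almost_faithful ::
  "nat \<Rightarrow> (K_elem \<Rightarrow> 's) \<Rightarrow> ('a, 'm) ring_scheme \<Rightarrow> ('a \<Rightarrow> 's) \<Rightarrow> ('s, 'n) ring_scheme \<Rightarrow> bool"
  where "almost_faithful p \<kappa> A \<phi> S \<longleftrightarrow>
    (\<forall>M :: ('a, (nat \<Rightarrow> 'a) set) module.
       Module.module A M \<and> almost_zero p \<kappa> (base_change A \<phi> S M) \<longrightarrow> carrier M = {\<zero>\<^bsub>M\<^esub>})"


section \<open>Perfectoid test ideals\<close>

(* In the following, \<phi> maps A to S and xs generates the maximal ideal of A. Multiplication by an
   element of S is an A-linear endomorphism of S, and S acts on the local cohomology of S by
   functoriality. *)

definition local_cohomology_act ::
  "('a, 'm) ring_scheme \<Rightarrow> 'a list \<Rightarrow> nat \<Rightarrow> ('a \<Rightarrow> 's) \<Rightarrow> ('s, 'n) ring_scheme \<Rightarrow> 's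
    \<Rightarrow> (nat set \<Rightarrow> ('s \<times> 'a) set) set \<Rightarrow> (nat set \<Rightarrow> ('s \<times> 'a) set) set"
  where "local_cohomology_act A xs d \<phi> S s =
    local_cohomology_map A xs d (algebra_module \<phi> S) (\<lambda>x. s \<otimes>\<^bsub>S\<^esub> x)"

definition diamond_zero ::
  "nat \<Rightarrow> (K_elem \<Rightarrow> 's) \<Rightarrow> ('a, 'm) ring_scheme \<Rightarrow> 'a list \<Rightarrow> nat \<Rightarrow> ('a \<Rightarrow> 's) \<Rightarrow> ('s, 'n) ring_scheme
    \<Rightarrow> 'a set \<Rightarrow> real \<Rightarrow> (nat set \<Rightarrow> ('a \<times> 'a) set) set set"
  where "diamond_zero p \<kappa> A xs d \<phi> S \<aa> t =
    {\<eta> \<in> carrier (local_cohomology A xs d (algebra_module (\<lambda>x. x) A)).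
       \<forall>e>0. \<forall>f \<in> ideal_power A \<aa> (nat \<lceil>t * real p ^ e\<rceil>). \<forall>g. compatible_roots p S (\<phi> f) g \<longrightarrow>
         (\<forall>k>0. local_cohomology_act A xs d \<phi> S (\<kappa> (K_root p k))
                  (local_cohomology_act A xs d \<phi> S (g e)
                    (local_cohomology_map A xs d (algebra_module \<phi> S) \<phi> \<eta>)) =
                \<zero>\<^bsub>local_cohomology A xs d (algebra_module \<phi> S)\<^esub>)}"

definition tau_sharp ::
  "nat \<Rightarrow> (K_elem \<Rightarrow> 's) \<Rightarrow> ('a, 'm) ring_scheme \<Rightarrow> 'a list \<Rightarrow> nat \<Rightarrow> ('a \<Rightarrow> 's) \<Rightarrow> ('s, 'n) ring_scheme
    \<Rightarrow> 'a set \<Rightarrow> real \<Rightarrow> 'a set"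
  where "tau_sharp p \<kappa> A xs d \<phi> S \<aa> t =
   (let H = local_cohomology A xs d (algebra_module (\<lambda>x. x) A) in
    {a \<in> carrier A. \<forall>\<eta> \<in> diamond_zero p \<kappa> A xs d \<phi> S \<aa> t. a \<odot>\<^bsub>H\<^esub> \<eta> = \<zero>\<^bsub>H\<^esub>})"

definition tau ::
  "nat \<Rightarrow> (K_elem \<Rightarrow> 's) \<Rightarrow> ('a, 'm) ring_scheme \<Rightarrow> 'a list \<Rightarrow> nat \<Rightarrow> ('a \<Rightarrow> 's) \<Rightarrow> ('s, 'n) ring_scheme
    \<Rightarrow> 'a set \<Rightarrow> real \<Rightarrow> 'a set"
  where "tau p \<kappa> A xs d \<phi> S \<aa> t = Idl\<^bsub>A\<^esub> (\<Union>t'\<in>{t<..}. tau_sharp p \<kappa> A xs d \<phi> S \<aa> t')"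

end

theory Submission
  imports Defs
begin

text \<open>
  Since \<open>n * \<lceil>s\<rceil> \<ge> \<lceil>n * s\<rceil>\<close>, the ideals defining \<open>\<tau>\<^sup>\<sharp>((\<aa>\<^sup>n)\<^sup>t)\<close> are contained in those defining
  \<open>\<tau>\<^sup>\<sharp>(\<aa>\<^sup>n\<^sup>t)\<close>. Conversely, let \<open>t < u < v\<close>. A root \<open>f\<^bsup>1/p^e\<^esup>\<close> with \<open>f \<in> \<aa>\<^bsup>\<lceil>n v p^e\<rceil>\<^esup>\<close> is also the root
  \<open>(f\<^bsup>p^c\<^esup>)\<^bsup>1/p^(e + c)\<^esup>\<close>, and for large \<open>c\<close> the gap \<open>n (v - u) p\<^bsup>e + c\<^esup>\<close> absorbs the rounding error \<open>n\<close>,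
  so that \<open>f\<^bsup>p^c\<^esup> \<in> (\<aa>\<^sup>n)\<^bsup>\<lceil>u p^(e + c)\<rceil>\<^esup>\<close>. The sum over \<open>t' > t\<close> leaves room for this perturbation.
\<close>

text \<open>Ideals form a semiring under sum and product, so this and the exponent laws below are
  facts about powers in a monoid.\<close>

lemma (in cring) ideal_power_ideal:
  assumes "ideal I R"
  shows "ideal (ideal_power R I n) R"
proof -
  interpret S: semiring "ideals_set R" by (rule ideals_set_is_semiring)
  show ?thesis using S.nat_pow_closed[of I n] assms by (simp add: ideals_set_def)
qed

lemma (in cring) ideal_power_power:
  assumes "ideal I R"
  shows "ideal_power R (ideal_power R I n) m = ideal_power R I (n * m)"
proof -
  interpret S: semiring "ideals_set R" by (rule ideals_set_is_semiring)
  show ?thesis using S.nat_pow_pow[of I n m] assms by (simp add: ideals_set_def)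
qed

lemma (in cring) ideal_power_add:
  assumes "ideal I R"
  shows "ideal_power R I (n + m) = ideal_power R I n \<cdot> ideal_power R I m"
proof -
  interpret S: semiring "ideals_set R" by (rule ideals_set_is_semiring)
  show ?thesis using S.nat_pow_mult[of I n m] assms by (simp add: ideals_set_def)
qed

lemma (in cring) ideal_power_antimono:
  assumes "ideal I R" "n \<le> m"
  shows "ideal_power R I m \<subseteq> ideal_power R I n"
proof -
  have "ideal_power R I m = ideal_power R I n \<cdot> ideal_power R I (m - n)"
    using ideal_power_add[OF assms(1), of n "m - n"] assms(2) by simp
  then show ?thesis
    using ideal_prod_inter ideal_power_ideal assms(1) by blast
qed

lemma (in cring) nat_pow_mem_ideal_power:
  assumes "ideal I R" "f \<in> ideal_power R I m"
  shows "f [^] q \<in> ideal_power R I (m * q)"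
proof (induction q)
  case 0
  \<comment> \<open>The zeroth ideal power is the unit of \<open>ideals_set R\<close>, that is, the
    whole ring.\<close>
  show ?case by (simp add: ideals_set_def)
next
  case (Suc q)
  have "f [^] q \<otimes> f \<in> ideal_power R I (m * q) \<cdot> ideal_power R I m"
    using Suc assms(2) by (rule ideal_prod.prod)
  then show ?case
    by (simp add: ideal_power_add[OF assms(1), symmetric] add.commute)
qed

lemma (in ring) compatible_roots_pow_add:
  assumes "compatible_roots p R x g"
  shows "g (e + c) [^] (p ^ c) = g e"
proof (induction c)
  case 0
  show ?case using assms by (simp add: compatible_roots_def)
next
  case (Suc c)
  have g: "g i \<in> carrier R" for i using assms by (simp add: compatible_roots_def)
  have "g (e + Suc c) [^] (p ^ Suc c) = (g (Suc (e + c)) [^] p) [^] (p ^ c)"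
    using g by (simp add: nat_pow_pow)
  then show ?case using Suc assms by (simp add: compatible_roots_def)
qed

text \<open>With \<open>q = p ^ c\<close>, the entry of the new system at level \<open>e + c\<close>
  is the old root \<open>g e\<close>, by the previous lemma.\<close>

lemma (in ring) compatible_roots_pow:
  assumes "compatible_roots p R x g"
  shows "compatible_roots p R (x [^] (q :: nat)) (\<lambda>e. g e [^] q)"
  unfolding compatible_roots_def
proof (intro conjI allI)
  show "(g (Suc e) [^] q) [^] p = g e [^] q" for e
  proof -
    have g: "g (Suc e) \<in> carrier R" using assms by (simp add: compatible_roots_def)
    have "(g (Suc e) [^] q) [^] p = (g (Suc e) [^] p) [^] q"
      using g by (simp add: nat_pow_pow mult.commute)
    then show ?thesis using assms by (simp add: compatible_roots_def)
  qed
qed (use assms in \<open>auto simp: compatible_roots_def\<close>)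

text \<open>Each condition at level \<open>e\<close> for \<open>J\<close> and \<open>v\<close> is a
  condition at level \<open>e + c\<close> for \<open>I\<close> and \<open>u\<close>, on
  \<open>f [^] (p ^ c)\<close> and the same root. The shift \<open>c\<close> may depend on
  \<open>e\<close>.\<close>

lemma diamond_zero_subset:
  assumes "cring A" "cring S" "\<phi> \<in> ring_hom A S" "ideal I A" "ideal J A"
    and c: "\<And>e. e > 0 \<Longrightarrow> \<exists>c. \<forall>f \<in> ideal_power A J (nat \<lceil>v * real p ^ e\<rceil>).
        f [^]\<^bsub>A\<^esub> (p ^ c) \<in> ideal_power A I (nat \<lceil>u * real p ^ (e + c)\<rceil>)"
  shows "diamond_zero p \<kappa> A xs d \<phi> S I u \<subseteq> diamond_zero p \<kappa> A xs d \<phi> S J v"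
proof
  interpret A: cring A by fact
  interpret S: cring S by fact
  interpret ring_hom_cring A S \<phi> by unfold_locales fact
  fix \<eta> assume \<eta>: "\<eta> \<in> diamond_zero p \<kappa> A xs d \<phi> S I u"
  let ?N = "local_cohomology_map A xs d (algebra_module \<phi> S) \<phi> \<eta>"
  have "local_cohomology_act A xs d \<phi> S (\<kappa> (K_root p k)) (local_cohomology_act A xs d \<phi> S (g e) ?N) =
        \<zero>\<^bsub>local_cohomology A xs d (algebra_module \<phi> S)\<^esub>"
    if e: "e > 0" and f: "f \<in> ideal_power A J (nat \<lceil>v * real p ^ e\<rceil>)"
      and g: "compatible_roots p S (\<phi> f) g" and k: "k > 0" for e f g k
  proof -
    obtain c where fc: "f [^]\<^bsub>A\<^esub> (p ^ c) \<in> ideal_power A I (nat \<lceil>u * real p ^ (e + c)\<rceil>)"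
      using c[OF e] f by blast
    have "f \<in> carrier A"
      using f ideal.Icarr[OF A.ideal_power_ideal[OF \<open>ideal J A\<close>]] by blast
    then have g': "compatible_roots p S (\<phi> (f [^]\<^bsub>A\<^esub> (p ^ c))) (\<lambda>i. g i [^]\<^bsub>S\<^esub> (p ^ c))"
      using S.compatible_roots_pow[OF g, of "p ^ c"] by simp
    \<comment> \<open>Unification with \<open>fc\<close> fixes the level as \<open>e + c\<close>,
      which is positive because \<open>e\<close> is.\<close>
    from \<eta>[unfolded diamond_zero_def, simplified, THEN conjunct2, rule_format, OF _ fc g' k] e
    have "local_cohomology_act A xs d \<phi> S (\<kappa> (K_root p k))
        (local_cohomology_act A xs d \<phi> S (g (e + c) [^]\<^bsub>S\<^esub> (p ^ c)) ?N) =
        \<zero>\<^bsub>local_cohomology A xs d (algebra_module \<phi> S)\<^esub>"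
      by simp
    then show ?thesis by (simp add: S.compatible_roots_pow_add[OF g])
  qed
  then show "\<eta> \<in> diamond_zero p \<kappa> A xs d \<phi> S J v"
    using \<eta> by (simp add: diamond_zero_def)
qed

text \<open>Annihilators reverse inclusions.\<close>

lemma tau_sharp_antimono:
  assumes "diamond_zero p \<kappa> A xs d \<phi> S I u \<subseteq> diamond_zero p \<kappa> A xs d \<phi> S J v"
  shows "tau_sharp p \<kappa> A xs d \<phi> S J v \<subseteq> tau_sharp p \<kappa> A xs d \<phi> S I u"
  using assms by (auto simp: tau_sharp_def Let_def)

text \<open>The right side is a natural number bounding \<open>n * x\<close> from above, also for
  negative \<open>x\<close>, where \<open>nat\<close> truncates to 0.\<close>

lemma nat_ceiling_mult_le:
  fixes x :: real
  shows "nat \<lceil>real n * x\<rceil> \<le> n * nat \<lceil>x\<rceil>"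
proof -
  have "real n * x \<le> real n * real (nat \<lceil>x\<rceil>)"
    by (rule mult_left_mono) linarith+
  then have "real n * x \<le> real (n * nat \<lceil>x\<rceil>)" by simp
  then show ?thesis by linarith
qed

lemma nat_ceiling_eventually_le:
  fixes u v :: real
  assumes "p > 1" "0 \<le> u" "u < v"
  obtains c where "n * nat \<lceil>u * real p ^ (e + c)\<rceil> \<le> nat \<lceil>real n * v * real p ^ e\<rceil> * p ^ c"
proof -
  \<comment> \<open>This makes the gap \<open>(v - u) * P\<close> exceed 1, the bound on the error
    of rounding up \<open>u * P\<close>.\<close>
  obtain c where c: "1 / (v - u) < real p ^ c"
    using real_arch_pow[of "real p"] assms(1) by auto
  define P where "P = real p ^ (e + c)"
  have "real p ^ c \<le> P"
    unfolding P_def using assms(1) by (intro power_increasing) auto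
  then have "(v - u) * real p ^ c \<le> (v - u) * P"
    using assms(3) by (intro mult_left_mono) auto
  moreover have "1 < (v - u) * real p ^ c"
    using c assms(3) by (simp add: field_simps)
  \<comment> \<open>Nonnegativity ensures that \<open>nat\<close> truncates nothing, so the rounded
    value is below \<open>u * P + 1\<close>.\<close>
  moreover have "0 \<le> u * P" using assms(2) by (simp add: P_def)
  ultimately have "real (nat \<lceil>u * P\<rceil>) \<le> v * P"
    by (simp add: left_diff_distrib) linarith
  then have "real n * real (nat \<lceil>u * P\<rceil>) \<le> real n * (v * P)"
    by (rule mult_left_mono) simp
  also have "\<dots> = (real n * v * real p ^ e) * real p ^ c"
    by (simp add: P_def power_add)
  also have "\<dots> \<le> real (nat \<lceil>real n * v * real p ^ e\<rceil>) * real p ^ c"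
    by (intro mult_right_mono real_nat_ceiling_ge) simp
  finally have "real (n * nat \<lceil>u * P\<rceil>) \<le> real (nat \<lceil>real n * v * real p ^ e\<rceil> * p ^ c)"
    by simp
  then show ?thesis using that unfolding P_def of_nat_le_iff by blast
qed

theorem proposition3p7:
  fixes p d n :: nat
    and A :: "'a ring" and \<mm> \<aa> :: "'a set" and xs :: "'a list"
    and A_inf :: "'s ring" and \<kappa> :: "K_elem \<Rightarrow> 's" and \<phi> :: "'a \<Rightarrow> 's"
    and t :: real
  assumes "Factorial_Ring.prime p"
    and "regular_local_ring A \<mm> d"
    and "adically_complete A \<mm>"
    and "mixed_characteristic A \<mm> p"
    and "set xs \<subseteq> carrier A" and "Idl\<^bsub>A\<^esub> (set xs) = \<mm>"
    and "integral_perfectoid p \<kappa> A_inf"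
    and "\<phi> \<in> ring_hom A A_inf"
    and "\<forall>f\<in>carrier A. \<exists>g. compatible_roots p A_inf (\<phi> f) g"
    and "almost_flat p \<kappa> A \<phi> A_inf"
    and "almost_faithful p \<kappa> A \<phi> A_inf"
    and "ideal \<aa> A"
    and "t \<ge> 0"
    and "n > 0"
  shows "tau p \<kappa> A xs d \<phi> A_inf (ideal_power A \<aa> n) t = tau p \<kappa> A xs d \<phi> A_inf \<aa> (real n * t)"
proof -
  interpret A: cring A
    using assms(2) by (simp add: regular_local_ring_def noetherian_local_ring_def)
  have S: "cring A_inf" using assms(7) by (simp add: integral_perfectoid_def)
  note \<aa> = \<open>ideal \<aa> A\<close>
  let ?\<tau> = "tau_sharp p \<kappa> A xs d \<phi> A_inf"
  have p: "p > 1" using assms(1) by (rule prime_gt_1_nat)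
  \<comment> \<open>Fewer test elements \<open>f\<close> give a larger \<open>diamond_zero\<close>,
    hence a smaller annihilator. The ideals are nested at every level \<open>e\<close>, so the shift
    is \<open>c = 0\<close>.\<close>
  have round_up: "?\<tau> (ideal_power A \<aa> n) v \<subseteq> ?\<tau> \<aa> (real n * v)" for v
  proof (intro tau_sharp_antimono diamond_zero_subset A.cring_axioms S assms(8) \<aa>
      A.ideal_power_ideal[OF \<aa>] exI[of _ 0] ballI)
    fix e f assume f: "f \<in> ideal_power A (ideal_power A \<aa> n) (nat \<lceil>v * real p ^ e\<rceil>)"
    have "nat \<lceil>real n * v * real p ^ (e + 0)\<rceil> \<le> n * nat \<lceil>v * real p ^ e\<rceil>"
      using nat_ceiling_mult_le[of n "v * real p ^ e"] by (simp add: mult.assoc)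
    then have "f \<in> ideal_power A \<aa> (nat \<lceil>real n * v * real p ^ (e + 0)\<rceil>)"
      using f A.ideal_power_antimono[OF \<aa>] unfolding A.ideal_power_power[OF \<aa>] by blast
    then show "f [^]\<^bsub>A\<^esub> (p ^ 0) \<in> ideal_power A \<aa> (nat \<lceil>real n * v * real p ^ (e + 0)\<rceil>)"
      using ideal.Icarr[OF A.ideal_power_ideal[OF \<aa>]] by simp
  qed
  have perturb: "?\<tau> \<aa> (real n * v) \<subseteq> ?\<tau> (ideal_power A \<aa> n) u" if uv: "0 \<le> u" "u < v" for u v
  proof (intro tau_sharp_antimono diamond_zero_subset A.cring_axioms S assms(8) \<aa>
      A.ideal_power_ideal[OF \<aa>])
    fix e :: nat
    obtain c where "n * nat \<lceil>u * real p ^ (e + c)\<rceil> \<le> nat \<lceil>real n * v * real p ^ e\<rceil> * p ^ c"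
      using nat_ceiling_eventually_le[OF p uv] .
    \<comment> \<open>The power of \<open>f\<close> lies in the power of \<open>\<aa>\<close> with
      exponent the right side of the bound, hence in the one with the smaller exponent on the
      left.\<close>
    then show "\<exists>c. \<forall>f\<in>ideal_power A \<aa> (nat \<lceil>real n * v * real p ^ e\<rceil>).
        f [^]\<^bsub>A\<^esub> (p ^ c) \<in> ideal_power A (ideal_power A \<aa> n) (nat \<lceil>u * real p ^ (e + c)\<rceil>)"
      using A.nat_pow_mem_ideal_power[OF \<aa>] A.ideal_power_antimono[OF \<aa>]
      unfolding A.ideal_power_power[OF \<aa>] by blast
  qed
  \<comment> \<open>Both sides of the goal are the ideals generated by these unions.\<close>
  have "(\<Union>v\<in>{t<..}. ?\<tau> (ideal_power A \<aa> n) v) = (\<Union>w\<in>{real n * t<..}. ?\<tau> \<aa> w)"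
  proof (intro equalityI UN_least)
    fix v assume "v \<in> {t<..}"
    then have "real n * v \<in> {real n * t<..}" using \<open>n > 0\<close> by simp
    then show "?\<tau> (ideal_power A \<aa> n) v \<subseteq> (\<Union>w\<in>{real n * t<..}. ?\<tau> \<aa> w)"
      using round_up by blast
  next
    fix w assume "w \<in> {real n * t<..}"
    then have "t < w / real n" using \<open>n > 0\<close> by (simp add: field_simps)
    \<comment> \<open>The ray \<open>{t<..}\<close> is open, so the exponent can drop strictly below
      \<open>w / real n\<close>, as \<open>perturb\<close> requires, and still exceed
      \<open>t\<close>.\<close>
    then obtain u where u: "t < u" "u < w / real n" using dense by blast
    have "?\<tau> \<aa> w \<subseteq> ?\<tau> (ideal_power A \<aa> n) u"
      using perturb[of u "w / real n"] u \<open>t \<ge> 0\<close> \<open>n > 0\<close> by simp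
    then show "?\<tau> \<aa> w \<subseteq> (\<Union>v\<in>{t<..}. ?\<tau> (ideal_power A \<aa> n) v)"
      using u by blast
  qed
  then show ?thesis by (simp add: tau_def)
qed

end
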